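(* Let $S$ be an exact semiring, let $m,n,p,q$ be positive integers, and let $A\in S^{m\times n}$ and $B\in S^{p\times q}$. Then the following conditions are equivalent. (1) $\operatorname{Row}(A)\cong\operatorname{Row}(B)$ as left $S$-modules. (2) $A\mathrel{\mathcal D}B$. (3) $\operatorname{Col}(A)\cong\operatorname{Col}(B)$ as right $S$-modules.
   Context: A semiring is a set $S$ with a commutative associative addition and an associative (not necessarily commutative) multiplication distributing over addition from both sides, such that for every non-empty finite subset $L\subseteq S$ there are local identities $0_L,1_L\in S$ with $a+0_Lb=1_La=a$ and $a+b0_L=a1_L=a$ for all $a,b\in L$. (No global zero or identity is required.) $S^{m\times n}$ is the set of $m\times n$ matrices over $S$, with the usual matrix addition and multiplication. For $A\in S^{m\times n}$, $\operatorname{Row}(A)=\{uA: u\in S^{1\times m}\}\subseteq S^{1\times n}$ (a left $S$-module) and $\operatorname{Col}(A)=\{Av: v\in S^{n\times 1}\}\subseteq S^{m\times 1}$ (a right $S$-module). An isomorphism of left $S$-modules is a bijection $\phi$ with $\phi(ax+by)=a(\phi x)+b(\phi y)$ for all elements $x,y$ and all $a,b\in S$; isomorphisms of right $S$-modules are defined similarly. A semiring $S$ is exact if for all positive integers $m,n$ and all $A\in S^{m\times n}$: (E1) if $x\in S^{1\times n}\setminus\operatorname{Row}(A)$ then there are $v,v'\in S^{n\times 1}$ with $Av=Av'$ but $xv\neq xv'$; and (E2) if $y\in S^{m\times 1}\setminus\operatorname{Col}(A)$ then there are $u,u'\in S^{1\times m}$ with $uA=u'A$ but $uy\neq u'y$.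 Green's relations for matrices over $S$: $A\in S^{m\times n}$ and $B\in S^{p\times n}$ satisfy $A\mathrel{\mathcal L}B$ if there are $M\in S^{p\times m}$ and $P\in S^{m\times p}$ with $MA=B$ and $PB=A$. $A\in S^{m\times n}$ and $B\in S^{m\times q}$ satisfy $A\mathrel{\mathcal R}B$ if there are $N\in S^{n\times q}$ and $Q\in S^{q\times n}$ with $AN=B$ and $BQ=A$. $A\in S^{m\times n}$ and $B\in S^{p\times q}$ satisfy $A\mathrel{\mathcal D}B$ if there is some $C\in S^{p\times n}$ with $A\mathrel{\mathcal L}C$ and $C\mathrel{\mathcal R}B$. *)

theory Defs
  imports "Jordan_Normal_Form.Matrix"
begin

text \<open>
  HOL's \<^class>\<open>semiring\<close> assumes neither a zero nor a one, nor commutative multiplication.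
\<close>

class semiring_local_id = semiring +
  assumes local_identities:
    "finite L \<Longrightarrow> L \<noteq> {} \<Longrightarrow>
      \<exists>z e. \<forall>a\<in>L. \<forall>b\<in>L. a + z * b = a \<and> e * a = a \<and> a + b * z = a \<and> a * e = a"

text \<open>
  Without a neutral element for addition, neither \<^const>\<open>sum\<close> nor the library's product
  of matrices is available.  \<open>sum_upto f n\<close> is the sum of the \<open>n + 1\<close> elements
  \<open>f 0, \<dots>, f n\<close>.
\<close>

primrec sum_upto :: "(nat \<Rightarrow> 'a::semiring) \<Rightarrow> nat \<Rightarrow> 'a" where
  "sum_upto f 0 = f 0"
| "sum_upto f (Suc n) = sum_upto f n + f (Suc n)"

text \<open>
  The product is meaningful only if the inner dimension is positive; all dimensions below are.
\<close>

definition mat_prod :: "'a::semiring mat \<Rightarrow> 'a mat \<Rightarrow> 'a mat" (infixl \<open>\<star>\<close> 70) where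
  "A \<star> B = mat (dim_row A) (dim_col B)
     (\<lambda>(i, j). sum_upto (\<lambda>k. A $$ (i, k) * B $$ (k, j)) (dim_row B - 1))"

lemma sum_upto_eq_sum: "sum_upto f n = sum f {..n}" for f :: "nat \<Rightarrow> 'a::semiring_0"
  by (induction n) auto

lemma mat_prod_eq_times:
  fixes A B :: "'a::semiring_0 mat"
  assumes "A \<in> carrier_mat m n" "B \<in> carrier_mat n p" "0 < n"
  shows "A \<star> B = A * B"
proof -
  have "{..n - Suc 0} = {0..<n}"
    using assms(3) by auto
  then show ?thesis
    using assms by (auto simp: mat_prod_def sum_upto_eq_sum scalar_prod_def intro!: eq_matI)
qed

lemma mat_prod_carrier [simp]:
  "A \<in> carrier_mat m n \<Longrightarrow> B \<in> carrier_mat n p \<Longrightarrow> A \<star> B \<in> carrier_mat m p"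
  by (auto simp: mat_prod_def)

text \<open>The left action on matrices is the library's \<open>a \<cdot>\<^sub>m x\<close>; this is the right action.\<close>

definition smult_mat_right :: "'a mat \<Rightarrow> 'a::semiring \<Rightarrow> 'a mat" (infixl \<open>\<cdot>\<^sub>r\<close> 70) where
  "x \<cdot>\<^sub>r a = map_mat (\<lambda>c. c * a) x"

text \<open>Row and column vectors are matrices with a single row or column.\<close>

definition Row :: "'a::semiring mat \<Rightarrow> 'a mat set" where
  "Row A = {u \<star> A | u. u \<in> carrier_mat 1 (dim_row A)}"

definition Col :: "'a::semiring mat \<Rightarrow> 'a mat set" where
  "Col A = {A \<star> v | v. v \<in> carrier_mat (dim_col A) 1}"

text \<open>
  Isomorphism of left and right modules, for sets of matrices that are closed under the
  respective linear combinations.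
\<close>

definition left_module_isomorphic :: "'a::semiring mat set \<Rightarrow> 'a mat set \<Rightarrow> bool" where
  "left_module_isomorphic X Y \<longleftrightarrow>
     (\<exists>\<phi>. bij_betw \<phi> X Y \<and>
       (\<forall>x\<in>X. \<forall>y\<in>X. \<forall>a b. \<phi> (a \<cdot>\<^sub>m x + b \<cdot>\<^sub>m y) = a \<cdot>\<^sub>m \<phi> x + b \<cdot>\<^sub>m \<phi> y))"

definition right_module_isomorphic :: "'a::semiring mat set \<Rightarrow> 'a mat set \<Rightarrow> bool" where
  "right_module_isomorphic X Y \<longleftrightarrow>
     (\<exists>\<phi>. bij_betw \<phi> X Y \<and>
       (\<forall>x\<in>X. \<forall>y\<in>X. \<forall>a b. \<phi> (x \<cdot>\<^sub>r a + y \<cdot>\<^sub>r b) = \<phi> x \<cdot>\<^sub>r a + \<phi> y \<cdot>\<^sub>r b))"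

definition exact :: "'a::semiring_local_id itself \<Rightarrow> bool" where
  "exact _ \<longleftrightarrow>
     (\<forall>m>0. \<forall>n>0. \<forall>A \<in> (carrier_mat m n :: 'a mat set).
       (\<forall>x \<in> carrier_mat 1 n - Row A.
          \<exists>v \<in> carrier_mat n 1. \<exists>v' \<in> carrier_mat n 1. A \<star> v = A \<star> v' \<and> x \<star> v \<noteq> x \<star> v') \<and>
       (\<forall>y \<in> carrier_mat m 1 - Col A.
          \<exists>u \<in> carrier_mat 1 m. \<exists>u' \<in> carrier_mat 1 m. u \<star> A = u' \<star> A \<and> u \<star> y \<noteq> u' \<star> y))"

definition green_L :: "'a::semiring mat \<Rightarrow> 'a mat \<Rightarrow> bool" where
  "green_L A B \<longleftrightarrow> dim_col A = dim_col B \<and>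
     (\<exists>M \<in> carrier_mat (dim_row B) (dim_row A). \<exists>P \<in> carrier_mat (dim_row A) (dim_row B).
        M \<star> A = B \<and> P \<star> B = A)"

definition green_R :: "'a::semiring mat \<Rightarrow> 'a mat \<Rightarrow> bool" where
  "green_R A B \<longleftrightarrow> dim_row A = dim_row B \<and>
     (\<exists>N \<in> carrier_mat (dim_col A) (dim_col B). \<exists>Q \<in> carrier_mat (dim_col B) (dim_col A).
        A \<star> N = B \<and> B \<star> Q = A)"

definition green_D :: "'a::semiring mat \<Rightarrow> 'a mat \<Rightarrow> bool" where
  "green_D A B \<longleftrightarrow>
     (\<exists>C \<in> carrier_mat (dim_row B) (dim_col A). green_L A C \<and> green_R C B)"

end

theory Submission
  imports Defs
begin

text \<open>
  Call a map \<open>\<phi>\<close> on a row space linear if it respects all combinations \<open>ax + by\<close>.  Since every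
  finite set of elements has local identities, the rows of \<open>A\<close> lie in \<open>Row A\<close>, and a linear map
  on \<open>Row A\<close> satisfies \<open>\<phi>(uA) = uC\<close>, where \<open>C\<close> is the matrix whose rows are the images of the
  rows of \<open>A\<close> (\<open>linear_mat_prod\<close>).

  Given an isomorphism \<open>\<phi>: Row A \<rightarrow> Row B\<close>, this \<open>C\<close> has the same row space as \<open>B\<close>, so
  \<open>B\<close> and \<open>C\<close> are \<open>\<L>\<close>-related.  As \<open>\<phi>\<close> is injective, \<open>uA = u'A\<close> if and only if \<open>uC = u'C\<close>.
  Exactness turns each direction of this equivalence into a factorization of one matrix through
  the other (\<open>exact_right_factor\<close>): a column of \<open>C\<close> outside \<open>Col A\<close> would be separated by some
  \<open>u, u'\<close> with \<open>uA = u'A\<close>.  So \<open>A\<close> and \<open>C\<close> are \<open>\<R>\<close>-related.  Conversely, if \<open>A\<close> and \<open>C\<close> are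
  \<open>\<L>\<close>-related and \<open>CN = B\<close>, \<open>BQ = C\<close>, then \<open>Row A = Row C\<close>, and \<open>x \<mapsto> xN\<close> is an isomorphism
  from \<open>Row C\<close> to \<open>Row B\<close>.  Together with the symmetry of \<open>\<D>\<close> this is the equivalence of
  the first two conditions.

  The statement on column spaces is the statement on row spaces for the transposed matrices over
  the opposite semiring, which is again exact.  Transposition exchanges \<open>\<L>\<close> and \<open>\<R>\<close> and thus
  fixes \<open>\<D>\<close>, because \<open>\<L>\<close> and \<open>\<R>\<close> commute.
\<close>

(* Keeps the dimension 1 of row and column vectors in this form. *)
declare One_nat_def [simp del]

section \<open>Non-empty sums and matrix products without zero and identity\<close>

lemma sum_upto_cong:
  "(\<And>k. k \<le> n \<Longrightarrow> f k = g k) \<Longrightarrow> sum_upto f n = sum_upto g n"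
  by (induction n) auto

lemma sum_upto_add:
  "sum_upto (\<lambda>k. f k + g k) n = sum_upto f n + sum_upto g n"
  by (induction n) (auto simp: ac_simps)

lemma sum_upto_distrib_left: "a * sum_upto f n = sum_upto (\<lambda>k. a * f k) n"
  by (induction n) (auto simp: distrib_left)

lemma sum_upto_distrib_right: "sum_upto f n * a = sum_upto (\<lambda>k. f k * a) n"
  by (induction n) (auto simp: distrib_right)

lemma sum_upto_swap:
  "sum_upto (\<lambda>i. sum_upto (f i) n) m = sum_upto (\<lambda>j. sum_upto (\<lambda>i. f i j) m) n"
  by (induction m) (auto simp: sum_upto_add)

text \<open>
  The substitute for a sum against a Kronecker delta: every term but the \<open>i\<close>-th acts as a zero
  on the value \<open>a\<close> of the \<open>i\<close>-th.  The case \<open>i > n\<close> is needed for the induction.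
\<close>

lemma sum_upto_absorb:
  assumes "\<And>k. k \<le> n \<Longrightarrow> k \<noteq> i \<Longrightarrow> a + f k = a" "f i = a"
  shows "if i \<le> n then sum_upto f n = a else a + sum_upto f n = a"
  using assms(1)
proof (induction n)
  case 0
  then show ?case using assms(2) by auto
next
  case (Suc n)
  have IH: "if i \<le> n then sum_upto f n = a else a + sum_upto f n = a"
    using Suc by auto
  consider "i \<le> n" | "i = Suc n" | "Suc n < i" by linarith
  then show ?case
  proof cases
    case 1
    then show ?thesis using IH Suc.prems[of "Suc n"] by auto
  next
    case 2
    then show ?thesis using IH assms(2) by (auto simp: add.commute)
  next
    case 3
    then show ?thesis using IH Suc.prems[of "Suc n"] by (auto simp flip: add.assoc)
  qed
qed

lemma mat_prod_index:
  "i < dim_row A \<Longrightarrow> j < dim_col B \<Longrightarrow>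
     (A \<star> B) $$ (i, j) = sum_upto (\<lambda>k. A $$ (i, k) * B $$ (k, j)) (dim_row B - 1)"
  by (simp add: mat_prod_def)

lemma mat_prod_dim [simp]: "dim_row (A \<star> B) = dim_row A" "dim_col (A \<star> B) = dim_col B"
  by (simp_all add: mat_prod_def)

lemma mat_prod_assoc:
  assumes "A \<in> carrier_mat m n" "B \<in> carrier_mat n p" "C \<in> carrier_mat p q" "0 < n" "0 < p"
  shows "A \<star> B \<star> C = A \<star> (B \<star> C)"
proof (rule eq_matI)
  fix i j assume "i < dim_row (A \<star> (B \<star> C))" "j < dim_col (A \<star> (B \<star> C))"
  then have ij: "i < m" "j < q" using assms by auto
  have "(A \<star> B \<star> C) $$ (i, j) =
      sum_upto (\<lambda>k. sum_upto (\<lambda>l. A $$ (i, l) * B $$ (l, k)) (n - 1) * C $$ (k, j)) (p - 1)"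
    using assms ij by (auto simp: mat_prod_index intro!: sum_upto_cong)
  also have "\<dots> = sum_upto (\<lambda>l. A $$ (i, l) *
      sum_upto (\<lambda>k. B $$ (l, k) * C $$ (k, j)) (p - 1)) (n - 1)"
    unfolding sum_upto_distrib_left sum_upto_distrib_right mult.assoc
    by (rule sum_upto_swap)
  also have "\<dots> = (A \<star> (B \<star> C)) $$ (i, j)"
    using assms ij by (auto simp: mat_prod_index intro!: sum_upto_cong)
  finally show "(A \<star> B \<star> C) $$ (i, j) = (A \<star> (B \<star> C)) $$ (i, j)" .
qed (use assms in auto)

lemma mat_prod_lincomb:
  assumes "u \<in> carrier_mat m n" "v \<in> carrier_mat m n" "A \<in> carrier_mat n p" "0 < n"
  shows "(a \<cdot>\<^sub>m u + b \<cdot>\<^sub>m v) \<star> A = a \<cdot>\<^sub>m (u \<star> A) + b \<cdot>\<^sub>m (v \<star> A)"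
proof (rule eq_matI)
  fix i j assume "i < dim_row (a \<cdot>\<^sub>m (u \<star> A) + b \<cdot>\<^sub>m (v \<star> A))"
    "j < dim_col (a \<cdot>\<^sub>m (u \<star> A) + b \<cdot>\<^sub>m (v \<star> A))"
  then have ij: "i < m" "j < p" using assms by auto
  have "((a \<cdot>\<^sub>m u + b \<cdot>\<^sub>m v) \<star> A) $$ (i, j) =
      sum_upto (\<lambda>k. a * (u $$ (i, k) * A $$ (k, j)) + b * (v $$ (i, k) * A $$ (k, j))) (n - 1)"
    using assms ij
    by (auto simp: mat_prod_index distrib_right mult.assoc intro!: sum_upto_cong)
  also have "\<dots> = (a \<cdot>\<^sub>m (u \<star> A) + b \<cdot>\<^sub>m (v \<star> A)) $$ (i, j)"
    using assms ij by (auto simp: mat_prod_index sum_upto_add sum_upto_distrib_left)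
  finally show "((a \<cdot>\<^sub>m u + b \<cdot>\<^sub>m v) \<star> A) $$ (i, j) = (a \<cdot>\<^sub>m (u \<star> A) + b \<cdot>\<^sub>m (v \<star> A)) $$ (i, j)" .
qed (use assms in auto)

section \<open>Local identities for matrices\<close>

lemma left_local_identities:
  fixes L :: "'a::semiring_local_id set"
  assumes "finite L"
  obtains z e where "\<And>a b. a \<in> L \<Longrightarrow> b \<in> L \<Longrightarrow> a + z * b = a" "\<And>a. a \<in> L \<Longrightarrow> e * a = a"
proof (cases "L = {}")
  case True
  then show thesis using that by blast
next
  case False
  then obtain z e where "\<forall>a\<in>L. \<forall>b\<in>L. a + z * b = a \<and> e * a = a \<and> a + b * z = a \<and> a * e = a"
    using local_identities[OF assms] by blast
  then show thesis using that[of z e] by blast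
qed

lemma index_in_elements_mat:
  "i < dim_row A \<Longrightarrow> j < dim_col A \<Longrightarrow> A $$ (i, j) \<in> elements_mat A"
  by (rule elements_matI[of A "dim_row A" "dim_col A" i j]) auto

lemma finite_elements_mat: "finite (elements_mat A)"
  by (simp add: elements_mat_def)

text \<open>The witness is the matrix with local identities on the diagonal and local zeros elsewhere.\<close>

lemma exists_left_identity_mat:
  fixes A :: "'a::semiring_local_id mat"
  assumes A: "A \<in> carrier_mat m n"
  obtains E where "E \<in> carrier_mat m m" "E \<star> A = A"
proof -
  obtain z e where z: "\<And>a b. a \<in> elements_mat A \<Longrightarrow> b \<in> elements_mat A \<Longrightarrow> a + z * b = a"
    and e: "\<And>a. a \<in> elements_mat A \<Longrightarrow> e * a = a"
    using left_local_identities[OF finite_elements_mat[of A]] by metis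
  define E where "E = mat m m (\<lambda>(i, j). if i = j then e else z)"
  have E: "E \<in> carrier_mat m m" by (simp add: E_def)
  have "(E \<star> A) $$ (i, j) = A $$ (i, j)" if ij: "i < m" "j < n" for i j
  proof -
    have in_A: "A $$ (k, j) \<in> elements_mat A" if "k < m" for k
      using A ij that by (auto intro!: index_in_elements_mat)
    have "(E \<star> A) $$ (i, j) = sum_upto (\<lambda>k. (if i = k then e else z) * A $$ (k, j)) (m - 1)"
      using A ij by (auto simp: E_def mat_prod_index intro!: sum_upto_cong)
    also have "\<dots> = A $$ (i, j)"
      using sum_upto_absorb[where n = "m - 1" and i = i and a = "A $$ (i, j)" and
          f = "\<lambda>k. (if i = k then e else z) * A $$ (k, j)"] ij in_A z e
      by (auto split: if_splits)
    finally show ?thesis .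
  qed
  then have "E \<star> A = A" using A E by (intro eq_matI) auto
  with E show thesis by (rule that)
qed

section \<open>Row and column spaces, and exactness\<close>

text \<open>The row of a matrix as a matrix with one row, and likewise for columns.\<close>

definition row_mat :: "'a mat \<Rightarrow> nat \<Rightarrow> 'a mat" where
  "row_mat A i = mat 1 (dim_col A) (\<lambda>(_, j). A $$ (i, j))"

definition col_mat :: "'a mat \<Rightarrow> nat \<Rightarrow> 'a mat" where
  "col_mat A j = mat (dim_row A) 1 (\<lambda>(i, _). A $$ (i, j))"

lemma row_mat_carrier [simp]: "A \<in> carrier_mat m n \<Longrightarrow> row_mat A i \<in> carrier_mat 1 n"
  by (auto simp: row_mat_def)

lemma col_mat_carrier [simp]: "A \<in> carrier_mat m n \<Longrightarrow> col_mat A j \<in> carrier_mat m 1"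
  by (auto simp: col_mat_def)

lemma row_mat_mat_prod:
  assumes "M \<in> carrier_mat m p" "A \<in> carrier_mat p n" "0 < p" "i < m"
  shows "row_mat (M \<star> A) i = row_mat M i \<star> A"
  using assms by (intro eq_matI) (auto simp: row_mat_def mat_prod_index intro!: sum_upto_cong)

lemma col_mat_mat_prod:
  assumes "A \<in> carrier_mat m p" "N \<in> carrier_mat p n" "0 < p" "j < n"
  shows "col_mat (A \<star> N) j = A \<star> col_mat N j"
  using assms by (intro eq_matI) (auto simp: col_mat_def mat_prod_index intro!: sum_upto_cong)

lemma eq_mat_rowsI:
  assumes "A \<in> carrier_mat m n" "B \<in> carrier_mat m n" "\<And>i. i < m \<Longrightarrow> row_mat A i = row_mat B i"
  shows "A = B"
proof (rule eq_matI)
  fix i j assume "i < dim_row B" "j < dim_col B"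
  moreover from this have "row_mat A i $$ (0, j) = row_mat B i $$ (0, j)" using assms by simp
  ultimately show "A $$ (i, j) = B $$ (i, j)" using assms(1,2) by (simp add: row_mat_def)
qed (use assms in auto)

lemma eq_mat_colsI:
  assumes "A \<in> carrier_mat m n" "B \<in> carrier_mat m n" "\<And>j. j < n \<Longrightarrow> col_mat A j = col_mat B j"
  shows "A = B"
proof (rule eq_matI)
  fix i j assume "i < dim_row B" "j < dim_col B"
  moreover from this have "col_mat A j $$ (i, 0) = col_mat B j $$ (i, 0)" using assms by simp
  ultimately show "A $$ (i, j) = B $$ (i, j)" using assms(1,2) by (simp add: col_mat_def)
qed (use assms in auto)

lemma Row_carrier: "A \<in> carrier_mat m n \<Longrightarrow> Row A \<subseteq> carrier_mat 1 n"
  by (auto simp: Row_def)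

lemma Row_lincomb:
  assumes A: "A \<in> carrier_mat m n" "0 < m" and xy: "x \<in> Row A" "y \<in> Row A"
  shows "a \<cdot>\<^sub>m x + b \<cdot>\<^sub>m y \<in> Row A"
proof -
  obtain u v where u: "u \<in> carrier_mat 1 m" "x = u \<star> A" and v: "v \<in> carrier_mat 1 m" "y = v \<star> A"
    using A xy by (auto simp: Row_def)
  have "a \<cdot>\<^sub>m x + b \<cdot>\<^sub>m y = (a \<cdot>\<^sub>m u + b \<cdot>\<^sub>m v) \<star> A"
    using mat_prod_lincomb u v A by metis
  then show ?thesis using A u v by (auto simp: Row_def)
qed

lemma row_mat_in_Row:
  fixes A :: "'a::semiring_local_id mat"
  assumes A: "A \<in> carrier_mat m n" "i < m"
  shows "row_mat A i \<in> Row A"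
proof -
  obtain E where E: "E \<in> carrier_mat m m" "E \<star> A = A"
    using exists_left_identity_mat[OF A(1)] .
  then have "row_mat A i = row_mat E i \<star> A"
    using row_mat_mat_prod[OF E(1) A(1)] A(2) by auto
  moreover have "row_mat E i \<in> carrier_mat 1 m" using E(1) by simp
  ultimately show ?thesis using A by (auto simp: Row_def)
qed

lemma left_factor_of_rows:
  assumes X: "X \<in> carrier_mat m n" and A: "A \<in> carrier_mat p n" "0 < p"
    and rows: "\<And>i. i < m \<Longrightarrow> row_mat X i \<in> Row A"
  shows "\<exists>M \<in> carrier_mat m p. M \<star> A = X"
proof -
  have "\<forall>i. \<exists>u. i < m \<longrightarrow> u \<in> carrier_mat 1 p \<and> row_mat X i = u \<star> A"
    using rows A by (fastforce simp: Row_def)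
  then obtain u where u: "\<And>i. i < m \<Longrightarrow> u i \<in> carrier_mat 1 p \<and> row_mat X i = u i \<star> A"
    by metis
  define M where "M = mat m p (\<lambda>(i, k). u i $$ (0, k))"
  have M: "M \<in> carrier_mat m p" by (simp add: M_def)
  have "row_mat M i = u i" if "i < m" for i
    using u[OF that] that by (intro eq_matI) (auto simp: M_def row_mat_def)
  then have "M \<star> A = X"
    using M A X u by - (rule eq_mat_rowsI[of _ m n], simp_all add: row_mat_mat_prod[OF M A])
  with M show ?thesis by blast
qed

lemma right_factor_of_cols:
  assumes X: "X \<in> carrier_mat m n" and A: "A \<in> carrier_mat m p" "0 < p"
    and cols: "\<And>j. j < n \<Longrightarrow> col_mat X j \<in> Col A"
  shows "\<exists>N \<in> carrier_mat p n. A \<star> N = X"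
proof -
  have "\<forall>j. \<exists>v. j < n \<longrightarrow> v \<in> carrier_mat p 1 \<and> col_mat X j = A \<star> v"
    using cols A by (fastforce simp: Col_def)
  then obtain v where v: "\<And>j. j < n \<Longrightarrow> v j \<in> carrier_mat p 1 \<and> col_mat X j = A \<star> v j"
    by metis
  define N where "N = mat p n (\<lambda>(k, j). v j $$ (k, 0))"
  have N: "N \<in> carrier_mat p n" by (simp add: N_def)
  have "col_mat N j = v j" if "j < n" for j
    using v[OF that] that by (intro eq_matI) (auto simp: N_def col_mat_def)
  then have "A \<star> N = X"
    using N A X v by - (rule eq_mat_colsI[of _ m n], simp_all add: col_mat_mat_prod[OF A(1) N A(2)])
  with N show ?thesis by blast
qed

lemma Row_subset_of_left_factor:
  assumes "A \<in> carrier_mat m n" "M \<in> carrier_mat p m" "0 < m" "0 < p"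
  shows "Row (M \<star> A) \<subseteq> Row A"
proof
  fix x assume "x \<in> Row (M \<star> A)"
  then obtain u where u: "u \<in> carrier_mat 1 p" "x = u \<star> (M \<star> A)"
    using assms by (auto simp: Row_def)
  then have "x = (u \<star> M) \<star> A" using mat_prod_assoc[OF u(1) assms(2,1)] assms by auto
  moreover have "u \<star> M \<in> carrier_mat 1 m" using u assms by auto
  ultimately show "x \<in> Row A" using assms by (auto simp: Row_def)
qed

lemma exact_row_separated:
  fixes A :: "'a::semiring_local_id mat"
  assumes "exact TYPE('a)" "0 < m" "0 < n" "A \<in> carrier_mat m n"
    and "x \<in> carrier_mat 1 n" "x \<notin> Row A"
  obtains v v' where "v \<in> carrier_mat n 1" "v' \<in> carrier_mat n 1" "A \<star> v = A \<star> v'"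
    "x \<star> v \<noteq> x \<star> v'"
proof -
  have "\<forall>x \<in> carrier_mat 1 n - Row A. \<exists>v \<in> carrier_mat n 1. \<exists>v' \<in> carrier_mat n 1.
      A \<star> v = A \<star> v' \<and> x \<star> v \<noteq> x \<star> v'"
    using bspec[OF assms(1)[unfolded exact_def, THEN spec, THEN mp, OF assms(2), THEN spec,
          THEN mp, OF assms(3)] assms(4)] by (rule conjunct1)
  then show thesis using assms(5,6) that by blast
qed

lemma exact_col_separated:
  fixes A :: "'a::semiring_local_id mat"
  assumes "exact TYPE('a)" "0 < m" "0 < n" "A \<in> carrier_mat m n"
    and "y \<in> carrier_mat m 1" "y \<notin> Col A"
  obtains u u' where "u \<in> carrier_mat 1 m" "u' \<in> carrier_mat 1 m" "u \<star> A = u' \<star> A"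
    "u \<star> y \<noteq> u' \<star> y"
proof -
  have "\<forall>y \<in> carrier_mat m 1 - Col A. \<exists>u \<in> carrier_mat 1 m. \<exists>u' \<in> carrier_mat 1 m.
      u \<star> A = u' \<star> A \<and> u \<star> y \<noteq> u' \<star> y"
    using bspec[OF assms(1)[unfolded exact_def, THEN spec, THEN mp, OF assms(2), THEN spec,
          THEN mp, OF assms(3)] assms(4)] by (rule conjunct2)
  then show thesis using assms(5,6) that by blast
qed

text \<open>
  The form in which exactness is used: a matrix \<open>C\<close> factors through \<open>A\<close> as soon as the kernel
  congruence of \<open>u \<mapsto> uA\<close> is contained in that of \<open>u \<mapsto> uC\<close>.
\<close>

lemma exact_right_factor:
  fixes A C :: "'a::semiring_local_id mat"
  assumes ex: "exact TYPE('a)" and pos: "0 < m" "0 < n"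
    and A: "A \<in> carrier_mat m n" and C: "C \<in> carrier_mat m q"
    and ker: "\<And>u u'. u \<in> carrier_mat 1 m \<Longrightarrow> u' \<in> carrier_mat 1 m \<Longrightarrow> u \<star> A = u' \<star> A
      \<Longrightarrow> u \<star> C = u' \<star> C"
  shows "\<exists>N \<in> carrier_mat n q. A \<star> N = C"
proof (rule right_factor_of_cols[OF C A pos(2)], rule ccontr)
  fix j assume j: "j < q" and notin: "col_mat C j \<notin> Col A"
  obtain u u' where u: "u \<in> carrier_mat 1 m" "u' \<in> carrier_mat 1 m" "u \<star> A = u' \<star> A"
    "u \<star> col_mat C j \<noteq> u' \<star> col_mat C j"
    using exact_col_separated[OF ex pos A _ notin] C by auto
  have "u \<star> C = u' \<star> C" using ker u(1-3) by blast
  then show False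
    using u(4) col_mat_mat_prod[OF u(1) C pos(1) j] col_mat_mat_prod[OF u(2) C pos(1) j] by simp
qed

section \<open>Linear maps on row spaces\<close>

text \<open>Linearity, as required of isomorphisms of left modules.\<close>

definition left_linear_on :: "'a::semiring mat set \<Rightarrow> ('a mat \<Rightarrow> 'a mat) \<Rightarrow> bool" where
  "left_linear_on X \<phi> \<longleftrightarrow>
     (\<forall>x\<in>X. \<forall>y\<in>X. \<forall>a b. \<phi> (a \<cdot>\<^sub>m x + b \<cdot>\<^sub>m y) = a \<cdot>\<^sub>m \<phi> x + b \<cdot>\<^sub>m \<phi> y)"

lemma add_absorb_smult_mat:
  assumes "elements_mat x \<subseteq> L" "elements_mat (a \<cdot>\<^sub>m x) \<subseteq> L"
    and "\<And>c d. c \<in> L \<Longrightarrow> d \<in> L \<Longrightarrow> c + z * d = c"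
  shows "a \<cdot>\<^sub>m x + z \<cdot>\<^sub>m x = a \<cdot>\<^sub>m x"
proof (rule eq_matI)
  fix i j assume ij: "i < dim_row (a \<cdot>\<^sub>m x)" "j < dim_col (a \<cdot>\<^sub>m x)"
  then have "x $$ (i, j) \<in> L" "(a \<cdot>\<^sub>m x) $$ (i, j) \<in> L"
    using assms(1,2) index_in_elements_mat[of i x j] index_in_elements_mat[of i "a \<cdot>\<^sub>m x" j]
    by auto
  then show "(a \<cdot>\<^sub>m x + z \<cdot>\<^sub>m x) $$ (i, j) = (a \<cdot>\<^sub>m x) $$ (i, j)" using assms(3) ij by auto
qed auto

lemma smult_mat_identity:
  assumes "elements_mat x \<subseteq> L" "\<And>c. c \<in> L \<Longrightarrow> e * c = c"
  shows "e \<cdot>\<^sub>m x = x"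
proof (rule eq_matI)
  fix i j assume ij: "i < dim_row x" "j < dim_col x"
  then have "x $$ (i, j) \<in> L" using assms(1) index_in_elements_mat[of i x j] by auto
  then show "(e \<cdot>\<^sub>m x) $$ (i, j) = x $$ (i, j)" using assms(2) ij by auto
qed auto

lemma exists_absorbing_scalar:
  fixes x y :: "'a::semiring_local_id mat"
  obtains z where "a \<cdot>\<^sub>m x + z \<cdot>\<^sub>m x = a \<cdot>\<^sub>m x" "a \<cdot>\<^sub>m y + z \<cdot>\<^sub>m y = a \<cdot>\<^sub>m y"
proof -
  define L where "L = elements_mat x \<union> elements_mat (a \<cdot>\<^sub>m x) \<union>
    elements_mat y \<union> elements_mat (a \<cdot>\<^sub>m y)"
  have "finite L" by (simp add: L_def finite_elements_mat)
  then obtain z e where z: "\<And>c d. c \<in> L \<Longrightarrow> d \<in> L \<Longrightarrow> c + z * d = c"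
    using left_local_identities[of L] by metis
  have "elements_mat x \<subseteq> L" "elements_mat (a \<cdot>\<^sub>m x) \<subseteq> L"
    "elements_mat y \<subseteq> L" "elements_mat (a \<cdot>\<^sub>m y) \<subseteq> L"
    unfolding L_def by blast+
  then show thesis using add_absorb_smult_mat z that by metis
qed

text \<open>A single multiple \<open>ax\<close> is the combination \<open>ax + zx\<close> for a local zero \<open>z\<close> that serves both
  \<open>x\<close> and \<open>\<phi> x\<close>.\<close>

lemma left_linear_on_smult:
  fixes \<phi> :: "'a::semiring_local_id mat \<Rightarrow> 'a mat"
  assumes lin: "left_linear_on X \<phi>" and x: "x \<in> X"
  shows "\<phi> (a \<cdot>\<^sub>m x) = a \<cdot>\<^sub>m \<phi> x"
proof -
  obtain z where z: "a \<cdot>\<^sub>m x + z \<cdot>\<^sub>m x = a \<cdot>\<^sub>m x" "a \<cdot>\<^sub>m \<phi> x + z \<cdot>\<^sub>m \<phi> x = a \<cdot>\<^sub>m \<phi> x"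
    by (rule exists_absorbing_scalar)
  have "\<phi> (a \<cdot>\<^sub>m x + z \<cdot>\<^sub>m x) = a \<cdot>\<^sub>m \<phi> x + z \<cdot>\<^sub>m \<phi> x"
    using lin x by (auto simp: left_linear_on_def)
  then show ?thesis by (simp add: z)
qed

text \<open>
  A summand without coefficient gets a local identity \<open>e\<close> with \<open>ex = x\<close> and \<open>e \<phi>(x) = \<phi>(x)\<close>.
  The first conclusion exhibits the sum as a linear combination, so that it stays in a set closed
  under these.
\<close>

lemma left_linear_on_add:
  fixes \<phi> :: "'a::semiring_local_id mat \<Rightarrow> 'a mat"
  assumes lin: "left_linear_on X \<phi>" and x: "x \<in> X" and y: "y \<in> X"
  obtains e where "x + b \<cdot>\<^sub>m y = e \<cdot>\<^sub>m x + b \<cdot>\<^sub>m y" "\<phi> (x + b \<cdot>\<^sub>m y) = \<phi> x + b \<cdot>\<^sub>m \<phi> y"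
proof -
  define L where "L = elements_mat x \<union> elements_mat (\<phi> x)"
  have "finite L" by (simp add: L_def finite_elements_mat)
  then obtain e where e: "\<And>c. c \<in> L \<Longrightarrow> e * c = c"
    using left_local_identities[of L] by metis
  have ex: "e \<cdot>\<^sub>m x = x" "e \<cdot>\<^sub>m \<phi> x = \<phi> x"
    using smult_mat_identity[of _ L e] e by (auto simp: L_def)
  have "\<phi> (e \<cdot>\<^sub>m x + b \<cdot>\<^sub>m y) = e \<cdot>\<^sub>m \<phi> x + b \<cdot>\<^sub>m \<phi> y"
    using lin x y by (auto simp: left_linear_on_def)
  then show thesis using ex that[of e] by simp
qed

text \<open>
  A linear map on \<open>Row A\<close> is determined by its values on the rows of \<open>A\<close>.  The proof adds up
  \<open>uA\<close> one row at a time; the partial sums stay in \<open>Row A\<close>.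
\<close>

lemma linear_mat_prod:
  fixes A C :: "'a::semiring_local_id mat"
  assumes A: "A \<in> carrier_mat m n" "0 < m" and C: "C \<in> carrier_mat m q"
    and lin: "left_linear_on (Row A) \<phi>"
    and rows: "\<And>i. i < m \<Longrightarrow> \<phi> (row_mat A i) = row_mat C i"
    and u: "u \<in> carrier_mat 1 m"
  shows "\<phi> (u \<star> A) = u \<star> C"
proof -
  define T where
    "T X k = mat 1 (dim_col X) (\<lambda>(_, j). sum_upto (\<lambda>i. u $$ (0, i) * X $$ (i, j)) k)" for X k
  have T0: "T X 0 = u $$ (0, 0) \<cdot>\<^sub>m row_mat X 0" for X
    by (intro eq_matI) (auto simp: T_def row_mat_def)
  have TSuc: "T X (Suc k) = T X k + u $$ (0, Suc k) \<cdot>\<^sub>m row_mat X (Suc k)" for X k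
    by (intro eq_matI) (auto simp: T_def row_mat_def)
  have T: "X \<in> carrier_mat m n' \<Longrightarrow> u \<star> X = T X (m - 1)" for X n'
    using u by (intro eq_matI) (auto simp: T_def mat_prod_index)
  have "T A k \<in> Row A \<and> \<phi> (T A k) = T C k" if "k < m" for k
    using that
  proof (induction k)
    case 0
    have r: "row_mat A 0 \<in> Row A" using row_mat_in_Row A by blast
    obtain z where z: "u $$ (0, 0) \<cdot>\<^sub>m row_mat A 0 + z \<cdot>\<^sub>m row_mat A 0 = u $$ (0, 0) \<cdot>\<^sub>m row_mat A 0"
      by (rule exists_absorbing_scalar)
    show ?case
      using left_linear_on_smult[OF lin r] rows A(2) Row_lincomb[OF A r r, of "u $$ (0, 0)" z] z
      by (simp add: T0)
  next
    case (Suc k)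
    have r: "row_mat A (Suc k) \<in> Row A" using row_mat_in_Row A Suc.prems by blast
    have t: "T A k \<in> Row A" "\<phi> (T A k) = T C k" using Suc by auto
    obtain e where "T A k + u $$ (0, Suc k) \<cdot>\<^sub>m row_mat A (Suc k) =
        e \<cdot>\<^sub>m T A k + u $$ (0, Suc k) \<cdot>\<^sub>m row_mat A (Suc k)"
      "\<phi> (T A k + u $$ (0, Suc k) \<cdot>\<^sub>m row_mat A (Suc k)) =
        \<phi> (T A k) + u $$ (0, Suc k) \<cdot>\<^sub>m \<phi> (row_mat A (Suc k))"
      using left_linear_on_add[OF lin t(1) r] .
    then show ?case
      using Row_lincomb[OF A t(1) r] t(2) rows Suc.prems by (metis TSuc)
  qed
  from this[of "m - 1"] show ?thesis using T A C by simp
qed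

section \<open>Green's relation and row spaces\<close>

lemma green_L_iff:
  assumes "A \<in> carrier_mat m n" "B \<in> carrier_mat p n"
  shows "green_L A B \<longleftrightarrow>
    (\<exists>M \<in> carrier_mat p m. M \<star> A = B) \<and> (\<exists>P \<in> carrier_mat m p. P \<star> B = A)"
  using assms by (simp add: green_L_def)

lemma green_R_iff:
  assumes "A \<in> carrier_mat m n" "B \<in> carrier_mat m q"
  shows "green_R A B \<longleftrightarrow>
    (\<exists>N \<in> carrier_mat n q. A \<star> N = B) \<and> (\<exists>Q \<in> carrier_mat q n. B \<star> Q = A)"
  using assms by (simp add: green_R_def)

lemma green_L_sym: "green_L A B \<Longrightarrow> green_L B A"
  unfolding green_L_def by metis

lemma green_R_sym: "green_R A B \<Longrightarrow> green_R B A"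
  unfolding green_R_def by metis

text \<open>The commutation of \<open>\<L>\<close> and \<open>\<R>\<close>: from \<open>PC = A\<close> and \<open>CN = B\<close> the matrix \<open>PB = AN\<close>
  links \<open>B\<close> to \<open>A\<close>.\<close>

lemma green_D_imp_converse:
  assumes pos: "0 < m" "0 < n" "0 < p" "0 < q"
    and A: "A \<in> carrier_mat m n" and B: "B \<in> carrier_mat p q" and D: "green_D A B"
  shows "green_D B A"
proof -
  obtain C M P N Q where C: "C \<in> carrier_mat p n"
    and M: "M \<in> carrier_mat p m" "P \<in> carrier_mat m p" "M \<star> A = C" "P \<star> C = A"
    and N: "N \<in> carrier_mat n q" "Q \<in> carrier_mat q n" "C \<star> N = B" "B \<star> Q = C"
    using D A B unfolding green_D_def green_L_def green_R_def
    by (metis carrier_matD(1) carrier_matD(2))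
  define C' where "C' = P \<star> B"
  have C': "C' \<in> carrier_mat m q" using M B by (simp add: C'_def)
  have AN: "A \<star> N = C'"
    using mat_prod_assoc[OF M(2) C N(1)] pos M N by (simp add: C'_def)
  have MC': "M \<star> C' = B"
    using mat_prod_assoc[OF M(1) A N(1)] pos M N AN by simp
  have C'Q: "C' \<star> Q = A"
    using mat_prod_assoc[OF M(2) B N(2)] pos M N by (simp add: C'_def)
  have "green_L B C'" using B C' M MC' by (auto simp: green_L_def C'_def)
  moreover have "green_R C' A" using A C' N AN C'Q by (auto simp: green_R_def)
  ultimately show ?thesis using A B C' by (auto simp: green_D_def)
qed

lemma green_D_sym:
  assumes "0 < m" "0 < n" "0 < p" "0 < q" "A \<in> carrier_mat m n" "B \<in> carrier_mat p q"
  shows "green_D A B \<longleftrightarrow> green_D B A"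
  using green_D_imp_converse[of m n p q A B] green_D_imp_converse[of p q m n B A] assms by blast

lemma Row_eq_of_green_L:
  assumes "0 < m" "0 < p" "A \<in> carrier_mat m n" "C \<in> carrier_mat p n" "green_L A C"
  shows "Row A = Row C"
proof -
  obtain M P where "M \<in> carrier_mat p m" "P \<in> carrier_mat m p" "M \<star> A = C" "P \<star> C = A"
    using assms by (auto simp: green_L_def)
  then show ?thesis
    using Row_subset_of_left_factor[of A m n M p] Row_subset_of_left_factor[of C p n P m] assms
    by auto
qed

lemma Row_iso_of_green_R:
  assumes pos: "0 < p" "0 < n" "0 < q"
    and C: "C \<in> carrier_mat p n" and B: "B \<in> carrier_mat p q" and R: "green_R C B"
  shows "left_module_isomorphic (Row C) (Row B)"
proof -
  obtain N Q where N: "N \<in> carrier_mat n q" "Q \<in> carrier_mat q n" "C \<star> N = B" "B \<star> Q = C"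
    using R C B by (auto simp: green_R_def)
  have uN: "u \<star> C \<star> N = u \<star> B" if "u \<in> carrier_mat 1 p" for u
    using mat_prod_assoc[OF that C N(1)] pos N by simp
  have uQ: "u \<star> B \<star> Q = u \<star> C" if "u \<in> carrier_mat 1 p" for u
    using mat_prod_assoc[OF that B N(2)] pos N by simp
  have Row_C: "Row C = (\<lambda>u. u \<star> C) ` carrier_mat 1 p"
    and Row_B: "Row B = (\<lambda>u. u \<star> B) ` carrier_mat 1 p"
    using C B by (auto simp: Row_def)
  have "bij_betw (\<lambda>x. x \<star> N) (Row C) (Row B)"
    by (rule bij_betw_byWitness[where f' = "\<lambda>x. x \<star> Q"])
      (simp_all add: Row_C Row_B image_image uN uQ cong: image_cong)
  moreover have "(a \<cdot>\<^sub>m x + b \<cdot>\<^sub>m y) \<star> N = a \<cdot>\<^sub>m (x \<star> N) + b \<cdot>\<^sub>m (y \<star> N)"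
    if "x \<in> Row C" "y \<in> Row C" for x y a b
    using mat_prod_lincomb[of x 1 n y N q a b] Row_carrier[OF C] that N pos by blast
  ultimately show ?thesis unfolding left_module_isomorphic_def by blast
qed

text \<open>
  The intermediate matrix \<open>C\<close>, with the images of the rows of \<open>A\<close> as its rows, has the size
  \<open>m \<times> q\<close>, so it links \<open>B\<close> to \<open>A\<close> rather than \<open>A\<close> to \<open>B\<close>.
\<close>

lemma green_D_of_Row_iso:
  fixes A B :: "'a::semiring_local_id mat"
  assumes ex: "exact TYPE('a)" and pos: "0 < m" "0 < n" "0 < p" "0 < q"
    and A: "A \<in> carrier_mat m n" and B: "B \<in> carrier_mat p q"
    and iso: "left_module_isomorphic (Row A) (Row B)"
  shows "green_D B A"
proof -
  obtain \<phi> where bij: "bij_betw \<phi> (Row A) (Row B)" and lin: "left_linear_on (Row A) \<phi>"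
    using iso by (auto simp: left_module_isomorphic_def left_linear_on_def)
  define C where "C = mat m q (\<lambda>(i, j). \<phi> (row_mat A i) $$ (0, j))"
  have C: "C \<in> carrier_mat m q" by (simp add: C_def)
  have row_B: "\<phi> (row_mat A i) \<in> Row B" if "i < m" for i
    using bij_betwE[OF bij] row_mat_in_Row[OF A that] by blast
  have rows: "\<phi> (row_mat A i) = row_mat C i" if "i < m" for i
    using row_B[OF that] Row_carrier[OF B] that
    by (intro eq_matI) (auto simp: C_def row_mat_def)
  have \<phi>: "\<phi> (u \<star> A) = u \<star> C" if "u \<in> carrier_mat 1 m" for u
    using linear_mat_prod[OF A pos(1) C lin rows that] by simp
  have in_Row: "u \<star> A \<in> Row A" if "u \<in> carrier_mat 1 m" for u
    using that A by (auto simp: Row_def)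
  have ker: "u \<star> A = u' \<star> A \<longleftrightarrow> u \<star> C = u' \<star> C"
    if "u \<in> carrier_mat 1 m" "u' \<in> carrier_mat 1 m" for u u'
    using \<phi> in_Row bij that by (metis bij_betw_def inj_onD)
  \<comment> \<open>Both factorizations give \<open>Row B = Row C\<close>; the second one uses that \<open>\<phi>\<close> is surjective.\<close>
  have "\<exists>P \<in> carrier_mat m p. P \<star> B = C"
    using left_factor_of_rows[OF C B pos(3)] row_B rows by simp
  moreover have "\<exists>M \<in> carrier_mat p m. M \<star> C = B"
  proof (rule left_factor_of_rows[OF B C pos(1)])
    fix i assume "i < p"
    then have "row_mat B i \<in> \<phi> ` Row A"
      using row_mat_in_Row[OF B] bij by (simp add: bij_betw_def)
    then show "row_mat B i \<in> Row C" using \<phi> A C by (auto simp: Row_def)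
  qed
  ultimately have "green_L B C" using B C by (auto simp: green_L_def)
  moreover have "green_R C A"
    using exact_right_factor[OF ex pos(1,2) A C] exact_right_factor[OF ex pos(1,4) C A] ker A C
    by (auto simp: green_R_def)
  ultimately show ?thesis using A B C by (auto simp: green_D_def)
qed

proposition Row_iso_iff_green_D:
  fixes A B :: "'a::semiring_local_id mat"
  assumes ex: "exact TYPE('a)" and pos: "0 < m" "0 < n" "0 < p" "0 < q"
    and A: "A \<in> carrier_mat m n" and B: "B \<in> carrier_mat p q"
  shows "left_module_isomorphic (Row A) (Row B) \<longleftrightarrow> green_D A B"
proof
  assume "left_module_isomorphic (Row A) (Row B)"
  then show "green_D A B"
    using green_D_of_Row_iso[OF ex pos A B] green_D_sym[OF pos A B] by blast
next
  assume "green_D A B"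
  then obtain C where C: "C \<in> carrier_mat p n" "green_L A C" "green_R C B"
    using A B by (auto simp: green_D_def)
  then show "left_module_isomorphic (Row A) (Row B)"
    using Row_eq_of_green_L[OF pos(1,3) A C(1,2)] Row_iso_of_green_R[OF pos(3,2,4) C(1) B C(3)]
    by simp
qed

section \<open>Duality through the opposite semiring\<close>

text \<open>The opposite semiring: the same elements and sums, and products in reverse order.\<close>

datatype 'a opp = Opp (unopp: 'a)

instantiation opp :: (semiring) semiring
begin

definition plus_opp :: "'a opp \<Rightarrow> 'a opp \<Rightarrow> 'a opp" where
  "x + y = Opp (unopp x + unopp y)"

definition times_opp :: "'a opp \<Rightarrow> 'a opp \<Rightarrow> 'a opp" where
  "x * y = Opp (unopp y * unopp x)"

instance
proof
  fix x y z :: "'a opp"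
  show "x + y + z = x + (y + z)" by (simp add: plus_opp_def add.assoc)
  show "x + y = y + x" by (simp add: plus_opp_def add.commute)
  show "x * y * z = x * (y * z)" by (simp add: times_opp_def mult.assoc)
  show "(x + y) * z = x * z + y * z" by (simp add: plus_opp_def times_opp_def distrib_left)
  show "x * (y + z) = x * y + x * z" by (simp add: plus_opp_def times_opp_def distrib_right)
qed

end

instance opp :: (semiring_local_id) semiring_local_id
proof
  fix L :: "'a opp set" assume "finite L" "L \<noteq> {}"
  then obtain z e where "\<forall>a \<in> unopp ` L. \<forall>b \<in> unopp ` L.
      a + z * b = a \<and> e * a = a \<and> a + b * z = a \<and> a * e = a"
    using local_identities[of "unopp ` L"] by blast
  then have "\<forall>a\<in>L. \<forall>b\<in>L. a + Opp z * b = a \<and> Opp e * a = a \<and> a + b * Opp z = a \<and> a * Opp e = a"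
    by (auto simp: plus_opp_def times_opp_def)
  then show "\<exists>z e. \<forall>a\<in>L. \<forall>b\<in>L. a + z * b = a \<and> e * a = a \<and> a + b * z = a \<and> a * e = a"
    by blast
qed

text \<open>The transpose, over the opposite semiring, and its inverse.\<close>

definition opp_mat :: "'a mat \<Rightarrow> 'a opp mat" where
  "opp_mat A = map_mat Opp (transpose_mat A)"

definition unopp_mat :: "'a opp mat \<Rightarrow> 'a mat" where
  "unopp_mat A = map_mat unopp (transpose_mat A)"

lemma opp_mat_dim [simp]:
  "dim_row (opp_mat A) = dim_col A" "dim_col (opp_mat A) = dim_row A"
  by (simp_all add: opp_mat_def)

lemma opp_mat_carrier_iff [simp]: "opp_mat A \<in> carrier_mat m n \<longleftrightarrow> A \<in> carrier_mat n m"
  unfolding carrier_mat_def by auto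

lemma unopp_opp_mat [simp]: "unopp_mat (opp_mat A) = A"
  by (rule eq_matI) (simp_all add: opp_mat_def unopp_mat_def)

lemma opp_unopp_mat [simp]: "opp_mat (unopp_mat A) = A"
  by (rule eq_matI) (simp_all add: opp_mat_def unopp_mat_def)

lemma unopp_mat_carrier_iff [simp]: "unopp_mat A \<in> carrier_mat m n \<longleftrightarrow> A \<in> carrier_mat n m"
  unfolding carrier_mat_def by (auto simp: unopp_mat_def)

lemma inj_opp_mat: "inj opp_mat"
  by (rule inj_on_inverseI[of _ unopp_mat]) simp

lemma opp_mat_eq_iff [simp]: "opp_mat A = opp_mat B \<longleftrightarrow> A = B"
  by (rule inj_eq[OF inj_opp_mat])

lemma ex_opp_mat: "(\<exists>x \<in> carrier_mat m n. P x) \<longleftrightarrow> (\<exists>x \<in> carrier_mat n m. P (opp_mat x))"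
proof
  assume "\<exists>x \<in> carrier_mat m n. P x"
  then obtain x where "x \<in> carrier_mat m n" "P x" by blast
  then show "\<exists>x \<in> carrier_mat n m. P (opp_mat x)" by (intro bexI[of _ "unopp_mat x"]) simp_all
next
  assume "\<exists>x \<in> carrier_mat n m. P (opp_mat x)"
  then show "\<exists>x \<in> carrier_mat m n. P x" using opp_mat_carrier_iff by blast
qed

lemma unopp_sum_upto: "unopp (sum_upto f n) = sum_upto (\<lambda>k. unopp (f k)) n"
  by (induction n) (auto simp: plus_opp_def)

lemma opp_mat_prod:
  assumes "A \<in> carrier_mat m n" "B \<in> carrier_mat n p" "0 < n"
  shows "opp_mat B \<star> opp_mat A = opp_mat (A \<star> B)"
  using assms
  by (intro eq_matI)
    (auto simp: opp_mat_def mat_prod_index unopp_sum_upto times_opp_def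
      intro!: opp.expand sum_upto_cong)

lemma opp_mat_lincomb:
  assumes "x \<in> carrier_mat m n" "y \<in> carrier_mat m n"
  shows "opp_mat (x \<cdot>\<^sub>r a + y \<cdot>\<^sub>r b) = Opp a \<cdot>\<^sub>m opp_mat x + Opp b \<cdot>\<^sub>m opp_mat y"
  using assms
  by (intro eq_matI) (auto simp: opp_mat_def smult_mat_right_def plus_opp_def times_opp_def)

lemma opp_mat_in_Row_iff:
  assumes "A \<in> carrier_mat m n" "0 < n"
  shows "opp_mat x \<in> Row (opp_mat A) \<longleftrightarrow> x \<in> Col A"
proof -
  have "opp_mat x \<in> Row (opp_mat A) \<longleftrightarrow> (\<exists>u \<in> carrier_mat 1 n. opp_mat x = u \<star> opp_mat A)"
    using assms by (auto simp: Row_def)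
  also have "\<dots> \<longleftrightarrow> (\<exists>v \<in> carrier_mat n 1. opp_mat x = opp_mat v \<star> opp_mat A)"
    by (rule ex_opp_mat)
  also have "\<dots> \<longleftrightarrow> x \<in> Col A"
    using assms by (auto simp: Col_def opp_mat_prod[OF assms(1) _ assms(2)])
  finally show ?thesis .
qed

lemma opp_mat_in_Col_iff:
  assumes "A \<in> carrier_mat m n" "0 < m"
  shows "opp_mat x \<in> Col (opp_mat A) \<longleftrightarrow> x \<in> Row A"
proof -
  have "opp_mat x \<in> Col (opp_mat A) \<longleftrightarrow> (\<exists>v \<in> carrier_mat m 1. opp_mat x = opp_mat A \<star> v)"
    using assms by (auto simp: Col_def)
  also have "\<dots> \<longleftrightarrow> (\<exists>u \<in> carrier_mat 1 m. opp_mat x = opp_mat A \<star> opp_mat u)"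
    by (rule ex_opp_mat)
  also have "\<dots> \<longleftrightarrow> x \<in> Row A"
    using assms by (auto simp: Row_def opp_mat_prod[OF _ assms])
  finally show ?thesis .
qed

lemma Row_opp_mat:
  assumes "A \<in> carrier_mat m n" "0 < n"
  shows "Row (opp_mat A) = opp_mat ` Col A"
proof (rule Set.set_eqI)
  fix x
  have "x \<in> Row (opp_mat A) \<longleftrightarrow> unopp_mat x \<in> Col A"
    using opp_mat_in_Row_iff[OF assms, of "unopp_mat x"] by simp
  then show "x \<in> Row (opp_mat A) \<longleftrightarrow> x \<in> opp_mat ` Col A"
    by (auto intro!: image_eqI[of _ _ "unopp_mat x"])
qed

lemma exact_opp:
  assumes ex: "exact TYPE('a::semiring_local_id)"
  shows "exact TYPE('a opp)"
  unfolding exact_def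
proof (intro allI impI ballI conjI)
  fix m n :: nat and A' x :: "'a opp mat"
  assume pos: "0 < m" "0 < n" and A': "A' \<in> carrier_mat m n" and x': "x \<in> carrier_mat 1 n - Row A'"
  define A y where "A = unopp_mat A'" and "y = unopp_mat x"
  have A: "A \<in> carrier_mat n m" "A' = opp_mat A" using A' by (simp_all add: A_def)
  have y: "y \<in> carrier_mat n 1" "x = opp_mat y" using x' by (simp_all add: y_def)
  have "y \<notin> Col A"
    using x' y opp_mat_in_Row_iff[OF A(1) pos(1)] by (simp add: A(2))
  then obtain u u' where u: "u \<in> carrier_mat 1 n" "u' \<in> carrier_mat 1 n" "u \<star> A = u' \<star> A"
    "u \<star> y \<noteq> u' \<star> y"
    by (rule exact_col_separated[OF ex pos(2,1) A(1) y(1)])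
  show "\<exists>v \<in> carrier_mat n 1. \<exists>v' \<in> carrier_mat n 1. A' \<star> v = A' \<star> v' \<and> x \<star> v \<noteq> x \<star> v'"
    using u
    by (intro bexI[of _ "opp_mat u"] bexI[of _ "opp_mat u'"])
      (simp_all add: A(2) y(2) opp_mat_prod[OF _ A(1) pos(2)] opp_mat_prod[OF _ y(1) pos(2)])
next
  fix m n :: nat and A' y :: "'a opp mat"
  assume pos: "0 < m" "0 < n" and A': "A' \<in> carrier_mat m n" and y': "y \<in> carrier_mat m 1 - Col A'"
  define A x where "A = unopp_mat A'" and "x = unopp_mat y"
  have A: "A \<in> carrier_mat n m" "A' = opp_mat A" using A' by (simp_all add: A_def)
  have x: "x \<in> carrier_mat 1 m" "y = opp_mat x" using y' by (simp_all add: x_def)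
  have "x \<notin> Row A"
    using x y' opp_mat_in_Col_iff[OF A(1) pos(2)] by (simp add: A(2))
  then obtain v v' where v: "v \<in> carrier_mat m 1" "v' \<in> carrier_mat m 1" "A \<star> v = A \<star> v'"
    "x \<star> v \<noteq> x \<star> v'"
    by (rule exact_row_separated[OF ex pos(2,1) A(1) x(1)])
  show "\<exists>u \<in> carrier_mat 1 m. \<exists>u' \<in> carrier_mat 1 m. u \<star> A' = u' \<star> A' \<and> u \<star> y \<noteq> u' \<star> y"
    using v
    by (intro bexI[of _ "opp_mat v"] bexI[of _ "opp_mat v'"])
      (simp_all add: A(2) x(2) opp_mat_prod[OF A(1) _ pos(1)] opp_mat_prod[OF x(1) _ pos(1)])
qed

lemma left_factor_opp_mat:
  assumes "A \<in> carrier_mat p m" "0 < m"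
  shows "(\<exists>M \<in> carrier_mat q m. M \<star> opp_mat A = opp_mat B) \<longleftrightarrow> (\<exists>N \<in> carrier_mat m q. A \<star> N = B)"
  unfolding ex_opp_mat[of q m] by (rule bex_cong) (simp_all add: opp_mat_prod[OF assms(1) _ assms(2)])

lemma right_factor_opp_mat:
  assumes "A \<in> carrier_mat m p" "0 < m"
  shows "(\<exists>N \<in> carrier_mat m q. opp_mat A \<star> N = opp_mat B) \<longleftrightarrow> (\<exists>M \<in> carrier_mat q m. M \<star> A = B)"
  unfolding ex_opp_mat[of m q] by (rule bex_cong) (simp_all add: opp_mat_prod[OF _ assms])

lemma green_L_opp_mat:
  assumes pos: "0 < m" "0 < q" and A: "A \<in> carrier_mat p m" and B: "B \<in> carrier_mat p q"
  shows "green_L (opp_mat A) (opp_mat B) \<longleftrightarrow> green_R A B"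
proof -
  have "opp_mat A \<in> carrier_mat m p" "opp_mat B \<in> carrier_mat q p" using A B by simp_all
  then show ?thesis
    unfolding green_R_iff[OF A B] by (simp only: green_L_iff left_factor_opp_mat[OF A pos(1)]
      left_factor_opp_mat[OF B pos(2)])
qed

lemma green_R_opp_mat:
  assumes pos: "0 < m" "0 < q" and A: "A \<in> carrier_mat m p" and B: "B \<in> carrier_mat q p"
  shows "green_R (opp_mat A) (opp_mat B) \<longleftrightarrow> green_L A B"
proof -
  have "opp_mat A \<in> carrier_mat p m" "opp_mat B \<in> carrier_mat p q" using A B by simp_all
  then show ?thesis
    unfolding green_L_iff[OF A B] by (simp only: green_R_iff right_factor_opp_mat[OF A pos(1)]
      right_factor_opp_mat[OF B pos(2)])
qed

lemma green_D_opp_mat: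
  assumes pos: "0 < m" "0 < n" "0 < p" "0 < q"
    and A: "A \<in> carrier_mat m n" and B: "B \<in> carrier_mat p q"
  shows "green_D (opp_mat A) (opp_mat B) \<longleftrightarrow> green_D A B"
proof -
  have "green_D (opp_mat A) (opp_mat B) \<longleftrightarrow>
      (\<exists>C \<in> carrier_mat m q. green_L (opp_mat A) (opp_mat C) \<and> green_R (opp_mat C) (opp_mat B))"
    using A B by (simp add: green_D_def ex_opp_mat[of q m])
  also have "\<dots> \<longleftrightarrow> (\<exists>C \<in> carrier_mat m q. green_R A C \<and> green_L C B)"
    using green_L_opp_mat[OF pos(2,4) A] green_R_opp_mat[OF pos(1,3) _ B] by blast
  also have "\<dots> \<longleftrightarrow> green_D B A"
    using A B green_L_sym green_R_sym unfolding green_D_def by (metis carrier_matD)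
  also have "\<dots> \<longleftrightarrow> green_D A B" using green_D_sym[OF pos A B] by simp
  finally show ?thesis .
qed

lemma Col_carrier: "A \<in> carrier_mat m n \<Longrightarrow> Col A \<subseteq> carrier_mat m 1"
  by (auto simp: Col_def)

lemma left_module_isomorphic_opp_mat:
  assumes X: "X \<subseteq> carrier_mat m n" and Y: "Y \<subseteq> carrier_mat p q"
  shows "left_module_isomorphic (opp_mat ` X) (opp_mat ` Y) \<longleftrightarrow> right_module_isomorphic X Y"
proof
  assume "right_module_isomorphic X Y"
  then obtain \<phi> where bij: "bij_betw \<phi> X Y"
    and lin: "\<And>x y a b. x \<in> X \<Longrightarrow> y \<in> X \<Longrightarrow> \<phi> (x \<cdot>\<^sub>r a + y \<cdot>\<^sub>r b) = \<phi> x \<cdot>\<^sub>r a + \<phi> y \<cdot>\<^sub>r b"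
    unfolding right_module_isomorphic_def by blast
  have b: "bij_betw (\<lambda>x. opp_mat (\<phi> (unopp_mat x))) (opp_mat ` X) (opp_mat ` Y)"
    using bij unfolding bij_betw_def inj_on_def by (auto simp: image_image)
  have l: "opp_mat (\<phi> (unopp_mat (a \<cdot>\<^sub>m opp_mat x + b \<cdot>\<^sub>m opp_mat y))) =
      a \<cdot>\<^sub>m opp_mat (\<phi> x) + b \<cdot>\<^sub>m opp_mat (\<phi> y)" if "x \<in> X" "y \<in> X" for x y a b
  proof -
    have "\<phi> x \<in> carrier_mat p q" "\<phi> y \<in> carrier_mat p q" using bij_betwE[OF bij] Y that by auto
    moreover have "x \<in> carrier_mat m n" "y \<in> carrier_mat m n" using X that by auto
    ultimately show ?thesis
      using opp_mat_lincomb[of x m n y "unopp a" "unopp b"] lin[OF that, of "unopp a" "unopp b"]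
        opp_mat_lincomb[of "\<phi> x" p q "\<phi> y" "unopp a" "unopp b"]
      by (metis opp.collapse unopp_opp_mat)
  qed
  show "left_module_isomorphic (opp_mat ` X) (opp_mat ` Y)"
    unfolding left_module_isomorphic_def
    by (rule exI[of _ "\<lambda>x. opp_mat (\<phi> (unopp_mat x))"]) (use b l in auto)
next
  assume "left_module_isomorphic (opp_mat ` X) (opp_mat ` Y)"
  then obtain \<phi> where bij: "bij_betw \<phi> (opp_mat ` X) (opp_mat ` Y)"
    and lin: "\<And>x y a b. x \<in> X \<Longrightarrow> y \<in> X \<Longrightarrow> \<phi> (a \<cdot>\<^sub>m opp_mat x + b \<cdot>\<^sub>m opp_mat y) =
      a \<cdot>\<^sub>m \<phi> (opp_mat x) + b \<cdot>\<^sub>m \<phi> (opp_mat y)"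
    unfolding left_module_isomorphic_def by blast
  define \<psi> where "\<psi> x = unopp_mat (\<phi> (opp_mat x))" for x
  have \<phi>: "\<phi> (opp_mat x) = opp_mat (\<psi> x)" for x by (simp add: \<psi>_def)
  have b: "bij_betw \<psi> X Y"
  proof -
    have "inj_on \<psi> X" using bij unfolding bij_betw_def inj_on_def by (auto simp: \<phi>)
    moreover have "opp_mat ` \<psi> ` X = opp_mat ` Y"
      using bij by (simp add: bij_betw_def image_image \<phi>)
    then have "\<psi> ` X = Y" by (simp add: inj_image_eq_iff[OF inj_opp_mat])
    ultimately show ?thesis by (simp add: bij_betw_def)
  qed
  have "\<psi> (x \<cdot>\<^sub>r a + y \<cdot>\<^sub>r b) = \<psi> x \<cdot>\<^sub>r a + \<psi> y \<cdot>\<^sub>r b" if "x \<in> X" "y \<in> X" for x y a b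
  proof -
    have "\<psi> x \<in> carrier_mat p q" "\<psi> y \<in> carrier_mat p q" using bij_betwE[OF b] Y that by auto
    moreover have "x \<in> carrier_mat m n" "y \<in> carrier_mat m n" using X that by auto
    ultimately have "opp_mat (\<psi> (x \<cdot>\<^sub>r a + y \<cdot>\<^sub>r b)) = opp_mat (\<psi> x \<cdot>\<^sub>r a + \<psi> y \<cdot>\<^sub>r b)"
      using lin[OF that, of "Opp a" "Opp b"] by (simp add: opp_mat_lincomb flip: \<phi>)
    then show ?thesis by simp
  qed
  with b show "right_module_isomorphic X Y" unfolding right_module_isomorphic_def by blast
qed

theorem theorem7p1:
  fixes A B :: "'a::semiring_local_id mat"
    and m n p q :: nat
  assumes "exact TYPE('a)"
    and "0 < m" and "0 < n" and "0 < p" and "0 < q"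
    and "A \<in> carrier_mat m n" and "B \<in> carrier_mat p q"
  shows "(left_module_isomorphic (Row A) (Row B) \<longleftrightarrow> green_D A B) \<and>
         (green_D A B \<longleftrightarrow> right_module_isomorphic (Col A) (Col B))"
proof
  note pos = assms(2-5) and A = assms(6) and B = assms(7)
  show "left_module_isomorphic (Row A) (Row B) \<longleftrightarrow> green_D A B"
    by (rule Row_iso_iff_green_D[OF assms])
  have "green_D A B \<longleftrightarrow> green_D (opp_mat A) (opp_mat B)"
    using green_D_opp_mat[OF pos A B] by simp
  also have "\<dots> \<longleftrightarrow> left_module_isomorphic (Row (opp_mat A)) (Row (opp_mat B))"
    using Row_iso_iff_green_D[OF exact_opp[OF assms(1)] pos(2,1,4,3), of "opp_mat A" "opp_mat B"]
      A B by simp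
  also have "\<dots> \<longleftrightarrow> right_module_isomorphic (Col A) (Col B)"
    using left_module_isomorphic_opp_mat[OF Col_carrier[OF A] Col_carrier[OF B]]
      Row_opp_mat[OF A pos(2)] Row_opp_mat[OF B pos(4)] by simp
  finally show "green_D A B \<longleftrightarrow> right_module_isomorphic (Col A) (Col B)" .
qed

end
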